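(* Let $C$ be a complete lattice and let $b\colon C \to C$ be a monotone, Scott cocontinuous map (i.e., $b$ preserves greatest lower bounds of directed chains). Let $\Omega_b \subseteq C$ be the sublattice consisting of the chain \[\top \sqsupseteq b(\top)\sqsupseteq bb(\top) \sqsupseteq \dots \sqsupseteq \nu b,\] where $\nu b$ is the greatest fixed point of $b$ (which, by cocontinuity, is the greatest lower bound of all $b^i(\top)$, $i\in\mathbb{N}$). Let $\omega_b\colon C \to C$ be the up-closure operator associated to $\Omega_b$, i.e., the up-closure whose set of pre-fixed points $Pre(\omega_b)=\{x\in C \mid \omega_b(x)\sqsubseteq x\}$ is exactly $\Omega_b$ (concretely, $\omega_b(x)$ is the greatest lower bound of the elements of $\Omega_b$ that are above $x$). Then $\omega_b$ is the greatest $b$-compatible map, that is: (1) $\omega_b$ is $b$-compatible, and (2) if a monotone map $a\colon C\to C$ is $b$-compatible, then $a\sqsubseteq \omega_b$ (pointwise). Moreover, (3) for any up-closure $a\colon C\to C$, $a\sqsubseteq \omega_b$ if and only if $\Omega_b \subseteq Pre(a)$.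
   Context: All maps are monotone and ordered pointwise. A monotone map $a\colon C \to C$ is called compatible w.r.t. $b$ ($b$-compatible) if $a \circ b \sqsubseteq b \circ a$. An up-closure operator is a monotone map $a$ with $x\sqsubseteq a(x)$ and $a(a(x))\sqsubseteq a(x)$ for all $x$; $Pre(a)$ denotes its set of pre-fixed points $\{x \mid a(x)\sqsubseteq x\}$, which is a complete lattice, and up-closures are in bijection with such subsets. $\top$ denotes the top element of $C$. *)

theory Defs
  imports "HOL-Library.Complete_Partial_Order2"
begin

(* cont only quantifies over nonempty chains, so scott_cocontinuous b does not
   force b top = top. *)
definition scott_cocontinuous :: "('a::complete_lattice \<Rightarrow> 'a) \<Rightarrow> bool" where
  "scott_cocontinuous b \<longleftrightarrow> cont Inf (\<ge>) Inf (\<ge>) b"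

(* The order on maps is the pointwise order of the function space. *)
definition compatible :: "('a::order \<Rightarrow> 'a) \<Rightarrow> ('a \<Rightarrow> 'a) \<Rightarrow> bool" where
  "compatible b a \<longleftrightarrow> mono a \<and> a \<circ> b \<le> b \<circ> a"

definition up_closure :: "('a::order \<Rightarrow> 'a) \<Rightarrow> bool" where
  "up_closure a \<longleftrightarrow> mono a \<and> (\<forall>x. x \<le> a x) \<and> (\<forall>x. a (a x) \<le> a x)"

definition Pre :: "('a::order \<Rightarrow> 'a) \<Rightarrow> 'a set" where
  "Pre a = {x. a x \<le> x}"

definition Omega :: "('a::complete_lattice \<Rightarrow> 'a) \<Rightarrow> 'a set" where
  "Omega b = range (\<lambda>i. (b ^^ i) top) \<union> {gfp b}"

definition omega :: "('a::complete_lattice \<Rightarrow> 'a) \<Rightarrow> 'a \<Rightarrow> 'a" where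
  "omega b x = Inf {y \<in> Omega b. x \<le> y}"

end

theory Submission
  imports Defs "HOL-Library.Order_Continuity"
begin

text \<open>
  An infinite meet of elements \<open>b\<^sup>i(\<top>)\<close> is \<open>\<nu>b\<close>, so \<open>\<omega>\<^sub>b(x)\<close> lies in \<open>\<Omega>\<^sub>b\<close>: it
  is \<open>\<nu>b\<close> or the last \<open>b\<^sup>i(\<top>)\<close> above \<open>x\<close>. As \<open>b\<close> maps \<open>\<Omega>\<^sub>b\<close> into itself, \<open>b(\<omega>\<^sub>b(x))\<close>
  is an element of \<open>\<Omega>\<^sub>b\<close> above \<open>b(x)\<close>, which gives compatibility. Conversely, a
  compatible map has every \<open>b\<^sup>i(\<top>)\<close> as a pre-fixed point by induction, and \<open>\<nu>b\<close>
  by coinduction; a monotone map lies below \<open>\<omega>\<^sub>b\<close> exactly when its pre-fixed points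
  include \<open>\<Omega>\<^sub>b\<close>.
\<close>

text \<open>The range of a decreasing sequence is a nonempty chain for \<open>(\<ge>)\<close>, so
  chain cocontinuity specializes to sequences, the form from which the iteration formula for
  \<open>gfp b\<close> follows.\<close>

lemma scott_cocontinuous_imp_inf_continuous:
  fixes b :: "'a::complete_lattice \<Rightarrow> 'a"
  assumes "scott_cocontinuous b"
  shows "inf_continuous b"
  unfolding inf_continuous_def
proof (intro allI impI)
  fix M :: "nat \<Rightarrow> 'a"
  assume "decseq M"
  then have "Complete_Partial_Order.chain (\<ge>) (range M)"
    by (auto simp: chain_def decseq_def) (metis nle_le)
  then have "b (Inf (range M)) = Inf (b ` range M)"
    using assms unfolding scott_cocontinuous_def by (auto dest: contD)
  then show "b (INF i. M i) = (INF i. b (M i))"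
    by (simp add: image_image)
qed

lemma gfp_in_Omega: "gfp b \<in> Omega b"
  by (simp add: Omega_def)

lemma funpow_top_in_Omega: "(b ^^ i) top \<in> Omega b"
  by (simp add: Omega_def)

lemma Omega_cases:
  assumes "y \<in> Omega b"
  obtains "y = gfp b" | i where "y = (b ^^ i) top"
  using assms by (auto simp: Omega_def)

lemma image_in_Omega:
  assumes "mono b" and "y \<in> Omega b"
  shows "b y \<in> Omega b"
  using assms(2)
proof (cases rule: Omega_cases)
  case 1
  then show ?thesis
    using gfp_unfold[OF assms(1)] gfp_in_Omega[of b] by simp
next
  case (2 i)
  then show ?thesis
    using funpow_top_in_Omega[where i = "Suc i" and b = b] by simp
qed

lemma le_omega: "x \<le> omega b x"
  by (auto simp: omega_def intro: Inf_greatest)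

lemma omega_le: "y \<in> Omega b \<Longrightarrow> x \<le> y \<Longrightarrow> omega b x \<le> y"
  by (auto simp: omega_def intro: Inf_lower)

lemma mono_omega: "mono (omega b)"
  by (auto simp: mono_def omega_def intro: Inf_superset_mono)

lemma omega_in_Omega:
  fixes b :: "'a::complete_lattice \<Rightarrow> 'a"
  assumes "mono b" and "gfp b = (INF i. (b ^^ i) top)"
  shows "omega b x \<in> Omega b"
proof (cases "\<forall>i. x \<le> (b ^^ i) top")
  case True
  then have "x \<le> gfp b"
    unfolding assms(2) by (auto intro: INF_greatest)
  then have "omega b x \<le> gfp b"
    by (simp add: omega_le gfp_in_Omega)
  \<comment> \<open>As the infimum of the iterates, \<open>gfp b\<close> is the least element of
    \<open>Omega b\<close>.\<close>
  moreover have "gfp b \<le> y" if "y \<in> Omega b" for y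
    using that unfolding assms(2) by (cases rule: Omega_cases) (auto simp: assms(2) intro: INF_lower)
  then have "gfp b \<le> omega b x"
    unfolding omega_def by (auto intro: Inf_greatest)
  ultimately show ?thesis
    using gfp_in_Omega by (metis antisym)
next
  case False
  define i where "i = (LEAST i. \<not> x \<le> (b ^^ i) top)"
  have i: "\<not> x \<le> (b ^^ i) top"
    unfolding i_def using LeastI_ex[of "\<lambda>i. \<not> x \<le> (b ^^ i) top"] False by blast
  have less: "x \<le> (b ^^ j) top" if "j < i" for j
    using not_less_Least that unfolding i_def by blast
  \<comment> \<open>\<open>i\<close> is not 0 because the zeroth iterate is \<open>top\<close>; so
    \<open>k\<close> indexes the last iterate above \<open>x\<close>.\<close>
  obtain k where k: "i = Suc k"
    using i by (cases i) auto
  have dec: "(b ^^ n) top \<le> (b ^^ m) top" if "m \<le> n" for m n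
    using funpow_increasing[OF that assms(1)] .
  have "(b ^^ k) top \<le> y" if "y \<in> Omega b" and "x \<le> y" for y
    using that(1)
  proof (cases rule: Omega_cases)
    case 1
    then have "x \<le> (b ^^ i) top"
      using that(2) unfolding assms(2) by (metis INF_lower UNIV_I order_trans)
    with i show ?thesis by simp
  next
    case (2 j)
    \<comment> \<open>Otherwise \<open>i \<le> j\<close>, and the descending chain would put
      \<open>x\<close> below iterate \<open>i\<close>.\<close>
    then have "j \<le> k"
      using i that(2) dec k by (metis not_less_eq_eq order_trans)
    then show ?thesis
      using 2 dec by simp
  qed
  then have "(b ^^ k) top \<le> omega b x"
    unfolding omega_def by (auto intro: Inf_greatest)
  moreover have "omega b x \<le> (b ^^ k) top"
    using less k by (simp add: omega_le funpow_top_in_Omega)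
  ultimately show ?thesis
    using funpow_top_in_Omega by (metis antisym)
qed

text \<open>For \<open>y\<close> in \<open>Omega b\<close>,
  \<open>a y \<le> omega b y \<le> y\<close>; conversely \<open>a x \<le> a y \<le> y\<close> for
  every such \<open>y\<close> above \<open>x\<close>. Stated for monotone maps, it serves both
  compatible maps and up-closures.\<close>

lemma le_omega_iff:
  assumes "mono a"
  shows "a \<le> omega b \<longleftrightarrow> Omega b \<subseteq> Pre a"
proof
  assume a: "a \<le> omega b"
  show "Omega b \<subseteq> Pre a"
  proof
    fix y assume "y \<in> Omega b"
    then have "omega b y \<le> y"
      by (simp add: omega_le)
    then show "y \<in> Pre a"
      using a by (auto simp: Pre_def le_fun_def intro: order_trans)
  qed
next
  assume sub: "Omega b \<subseteq> Pre a"
  have "a x \<le> y" if "y \<in> Omega b" and "x \<le> y" for x y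
    using that sub monoD[OF assms that(2)] by (auto simp: Pre_def intro: order_trans)
  then show "a \<le> omega b"
    unfolding le_fun_def omega_def by (auto intro: Inf_greatest)
qed

lemma compatible_imp_Omega_subset_Pre:
  fixes b :: "'a::complete_lattice \<Rightarrow> 'a"
  assumes "mono b" and "compatible b a"
  shows "Omega b \<subseteq> Pre a"
proof
  have comp: "a (b x) \<le> b (a x)" for x
    using assms(2) by (auto simp: compatible_def le_fun_def)
  fix y assume "y \<in> Omega b"
  then show "y \<in> Pre a"
  proof (cases rule: Omega_cases)
    case 1
    \<comment> \<open>Compatibility makes \<open>a (gfp b)\<close> a post-fixed point of
      \<open>b\<close>, hence below \<open>gfp b\<close>.\<close>
    have "a (gfp b) \<le> b (a (gfp b))"
      using comp[of "gfp b"] gfp_unfold[OF assms(1)] by simp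
    then show ?thesis
      using 1 by (simp add: Pre_def gfp_upperbound)
  next
    case (2 i)
    have "a ((b ^^ i) top) \<le> (b ^^ i) top"
    proof (induction i)
      case (Suc i)
      then show ?case
        using comp[of "(b ^^ i) top"] monoD[OF assms(1) Suc.IH] by simp
    qed simp
    with 2 show ?thesis
      by (simp add: Pre_def)
  qed
qed

lemma up_closure_omega:
  assumes "\<And>x. omega b x \<in> Omega b"
  shows "up_closure (omega b)"
  using assms by (simp add: up_closure_def mono_omega le_omega omega_le)

lemma Pre_omega:
  assumes "\<And>x. omega b x \<in> Omega b"
  shows "Pre (omega b) = Omega b"
proof
  show "Pre (omega b) \<subseteq> Omega b"
    using assms le_omega by (metis (mono_tags) Pre_def antisym mem_Collect_eq subsetI)
  show "Omega b \<subseteq> Pre (omega b)"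
    by (auto simp: Pre_def omega_le)
qed

text \<open>An up-closure is determined by its pre-fixed points: by idempotence \<open>a x\<close>
  is one of them, and it lies above \<open>x\<close>, so \<open>omega b x\<close> is below
  it.\<close>

lemma up_closure_eq_omega:
  assumes "up_closure a" and "Pre a = Omega b"
  shows "a = omega b"
proof (rule antisym)
  show "a \<le> omega b"
    using assms by (simp add: le_omega_iff up_closure_def)
  have "a x \<in> Omega b" "x \<le> a x" for x
    using assms by (auto simp: up_closure_def Pre_def)
  then show "omega b \<le> a"
    by (simp add: le_fun_def omega_le)
qed

lemma compatible_omega:
  assumes "mono b" and "\<And>x. omega b x \<in> Omega b"
  shows "compatible b (omega b)"
proof -
  have "omega b (b x) \<le> b (omega b x)" for x
    using assms by (intro omega_le image_in_Omega monoD[OF assms(1)] le_omega)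
  then show ?thesis
    by (simp add: compatible_def le_fun_def mono_omega)
qed

theorem theorem8p2:
  fixes b :: "'a::complete_lattice \<Rightarrow> 'a"
  assumes "mono b" and "scott_cocontinuous b"
  shows "gfp b = (INF i. (b ^^ i) top) \<and>
    (\<forall>a. up_closure a \<and> Pre a = Omega b \<longleftrightarrow> a = omega b) \<and>
    compatible b (omega b) \<and>
    (\<forall>a. mono a \<and> compatible b a \<longrightarrow> a \<le> omega b) \<and>
    (\<forall>a. up_closure a \<longrightarrow> (a \<le> omega b \<longleftrightarrow> Omega b \<subseteq> Pre a))"
proof -
  have gfp: "gfp b = (INF i. (b ^^ i) top)"
    using assms(2) by (intro inf_continuous_gfp scott_cocontinuous_imp_inf_continuous)
  have "omega b x \<in> Omega b" for x
    using omega_in_Omega[OF assms(1) gfp] .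
  then have "up_closure a \<and> Pre a = Omega b \<longleftrightarrow> a = omega b" for a
    using up_closure_omega Pre_omega up_closure_eq_omega by metis
  moreover have "compatible b (omega b)"
    using assms(1) omega_in_Omega[OF assms(1) gfp] by (rule compatible_omega)
  moreover have "a \<le> omega b" if "mono a" "compatible b a" for a
    using that compatible_imp_Omega_subset_Pre[OF assms(1)] by (simp add: le_omega_iff)
  moreover have "a \<le> omega b \<longleftrightarrow> Omega b \<subseteq> Pre a" if "up_closure a" for a
    using that by (simp add: le_omega_iff up_closure_def)
  ultimately show ?thesis
    using gfp by blast
qed

end
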